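(* Let $x^\dagger\in\mathcal{D}(F)$ with $F(x^\dagger)=y$, let $\bar\delta>0$, $\tau>1$, and let $(y^\delta)_{\delta\in(0,\bar\delta]}\subseteq Y$ satisfy $\mathcal{S}(y,y^\delta)\le\delta$. Let $F$ be weakly sequentially closed at $y$ in the sense that for all sequences $(y_k)\subseteq Y$, $(x_k)\subseteq\mathcal{D}(F)$: $$x_k\rightharpoonup x,\ \ \mathcal{S}(F(x_k),y_k)\to0,\ \ \mathcal{S}(y,y_k)\to0\ \Longrightarrow\ x\in\mathcal{D}(F)\text{ and }F(x)=y.$$ Let $\varphi$ be an index function. For every $\delta\in(0,\bar\delta]$ let a discretization level $n=n(\delta)$, real tolerances $\eta_n^\delta,\underline{\eta}_n^\delta,\overline{\eta}_n^\delta$, a radius $\rho=\rho(\delta)\ge0$ and an element $\hat{x}^\delta:=\hat{x}_{n(\delta),\rho(\delta)}^\delta\in X_{n(\delta)}\cap\mathcal{D}(F)$ be given such that $$\|\hat{x}^\delta\|_n^2\le\rho,\qquad r_n^\delta(\hat{x}^\delta)\le\min\{r_n^\delta(x_n):x_n\in X_n,\ \|x_n\|_n^2\le\rho\}+\eta_n^\delta,$$ $$\delta+\underline{\eta}_n^\delta<r_n^\delta(\hat{x}^\delta)\le\tau\delta+\overline{\eta}_n^\delta,$$ $$\eta_n^\delta\ge0,\qquad\underline{\eta}_n^\delta<(\tau-1)\delta+\overline{\eta}_n^\delta,\qquad\underline{\eta}_n^\delta-\eta_n^\delta\ge r_n^\delta(P_nx^\dagger)-r^\delta(x^\dagger),$$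 and $$\|P_nx^\dagger\|_n^2-\|x^\dagger\|^2\le C_{1,1}\varphi(C_2\delta),\qquad\|\hat{x}^\delta\|^2-\|\hat{x}^\delta\|_n^2\le C_{1,2}\varphi(C_2\delta),$$ $$r^\delta(\hat{x}^\delta)-r_n^\delta(\hat{x}^\delta)\le\tau_1\delta,\qquad\overline{\eta}_n^\delta\le\tau_2\delta,$$ where $n=n(\delta)$ and $\tau_1,\tau_2,C_{1,1},C_{1,2},C_2>0$ are constants independent of $\delta$. Then the following holds. (1) $\hat{x}_{n(\delta),\rho(\delta)}^\delta$ converges subsequentially as $\delta\to0$ in the following sense. There exists a weakly convergent subsequence $(\hat{x}^{\delta_k})_{k\in\mathbb{N}}$ with $\delta_k\to0$, and the limit $x^*$ of every such weakly convergent subsequence satisfies $F(x^* )=y$. If for such a subsequence with limit $x^*$ one has $\limsup_{k\to\infty}\|\hat{x}^{\delta_k}\|^2\le\|x^*\|^2$, then $\hat{x}^{\delta_k}\to x^*$ strongly. If $x^\dagger$ is the unique solution of $F(x)=y$, then $\hat{x}^\delta\rightharpoonup x^\dagger$ as $\delta\to0$, and $\hat{x}^\delta\to x^\dagger$ strongly if $\limsup_{\delta\to0}\|\hat{x}^\delta\|^2\le\|x^\dagger\|^2$. (2) If additionally, for some $R>0$, the variational source condition $$\exists\,\beta\in(0,1)\ \ \forall x\in\mathcal{B}_R(x^\dagger)\cap\mathcal{D}(F):\quad2(x^\dagger,x^\dagger-x)\le\beta\|x^\dagger-x\|^2+\varphi\bigl(\mathcal{S}(F(x^\dagger),F(x))\bigr)$$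 and, for some $C_4>0$, the generalized triangle inequality $\mathcal{S}(y_1,y_2)\le C_4(\mathcal{S}(y_1,y_3)+\mathcal{S}(y_2,y_3))$ for all $y_1,y_2,y_3\in Y$ hold, then $$\|\hat{x}_{n(\delta),\rho(\delta)}^\delta-x^\dagger\|^2=O(\varphi(C\delta))\quad\text{as }\delta\to0,$$ with $C=\max\{C_2,\,C_4(\tau+\tau_1+\tau_2+1)\}$.
   Context: $X$ is a Hilbert space with inner product $(\cdot,\cdot)$ and norm $\|\cdot\|$, $Y$ is a Banach space, $F:\mathcal{D}(F)\subseteq X\to Y$ is an operator, $y\in Y$, and $\mathcal{S}:Y\times Y\to\mathbb{R}^+=[0,\infty)$ is a distance measure. For each $n\in\mathbb{N}$, $X_n\subseteq X$ is a finite-dimensional subspace with a norm $\|\cdot\|_n$ (induced by an inner product), $P_n$ is the orthogonal projection of $X$ onto $X_n$, and $F_n:X_n\to Y$ and $\mathcal{S}_n:Y\times Y\to\mathbb{R}$ are approximations of $F$ and $\mathcal{S}$. Set $r^\delta(x):=\mathcal{S}(F(x),y^\delta)$ for $x\in\mathcal{D}(F)$ and $r_n^\delta(x_n):=\mathcal{S}_n(F_n(x_n),y^\delta)$ for $x_n\in X_n$. The minima of $r_n^\delta$ over the sets $\{x_n\in X_n:\|x_n\|_n^2\le\rho\}$, $\rho\ge 0$, are assumed to be attained. $\mathcal{B}_R(x^\dagger)$ is the ball of radius $R$ around $x^\dagger$ in $X$; $\rightharpoonup$ denotes weak convergence in $X$. An index function is a monotonically increasing function $\varphi:\mathbb{R}^+\to\mathbb{R}^+$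 with $\lim_{t\to0}\varphi(t)=0$.
   Formalization: Part (2) fails for arbitrary R (e.g. F(x)=(x−1)(x−3), x†=3, R=1); the formal version also assumes that B_R(x†) contains all solutions of norm at most ‖x†‖, or that x̂^δ lies in B_R(x†) for all small δ; the latter is implied by the claimed rate. *)

theory Defs
  imports "HOL-Analysis.Analysis" "HOL-Library.Landau_Symbols"
begin

definition weakly_tendsto ::
    "('i \<Rightarrow> 'a::real_normed_vector) \<Rightarrow> 'a \<Rightarrow> 'i filter \<Rightarrow> bool" where
  "weakly_tendsto u x G \<longleftrightarrow>
     (\<forall>f::'a \<Rightarrow> real. bounded_linear f \<longrightarrow> ((\<lambda>t. f (u t)) \<longlongrightarrow> f x) G)"

definition finite_dim_subspace :: "'a::real_vector set \<Rightarrow> bool" where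
  "finite_dim_subspace V \<longleftrightarrow> subspace V \<and> (\<exists>B. finite B \<and> span B = V)"

definition inner_product_on :: "'a::real_vector set \<Rightarrow> ('a \<Rightarrow> 'a \<Rightarrow> real) \<Rightarrow> bool" where
  "inner_product_on V ip \<longleftrightarrow>
     (\<forall>u\<in>V. \<forall>v\<in>V. ip u v = ip v u) \<and>
     (\<forall>u\<in>V. \<forall>v\<in>V. \<forall>w\<in>V. ip (u + v) w = ip u w + ip v w) \<and>
     (\<forall>c. \<forall>u\<in>V. \<forall>v\<in>V. ip (c *\<^sub>R u) v = c * ip u v) \<and>
     (\<forall>u\<in>V. u \<noteq> 0 \<longrightarrow> 0 < ip u u)"

definition norm_on_by_inner_product :: "'a::real_vector set \<Rightarrow> ('a \<Rightarrow> real) \<Rightarrow> bool" where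
  "norm_on_by_inner_product V N \<longleftrightarrow>
     (\<exists>ip. inner_product_on V ip \<and> (\<forall>v\<in>V. N v = sqrt (ip v v)))"

definition orthogonal_projection_onto :: "'a::real_inner set \<Rightarrow> ('a \<Rightarrow> 'a) \<Rightarrow> bool" where
  "orthogonal_projection_onto V P \<longleftrightarrow>
     (\<forall>x. P x \<in> V \<and> (\<forall>v\<in>V. orthogonal (x - P x) v))"

definition index_function :: "(real \<Rightarrow> real) \<Rightarrow> bool" where
  "index_function \<phi> \<longleftrightarrow>
     (\<forall>t\<ge>0. 0 \<le> \<phi> t) \<and> mono_on {0..} \<phi> \<and> (\<phi> \<longlongrightarrow> 0) (at_right 0)"

definition weakly_seq_closed_at ::
    "'a::real_normed_vector set \<Rightarrow> ('a \<Rightarrow> 'b) \<Rightarrow> ('b \<Rightarrow> 'b \<Rightarrow> real) \<Rightarrow> 'b \<Rightarrow> bool" where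
  "weakly_seq_closed_at D F S y \<longleftrightarrow>
     (\<forall>(ys :: nat \<Rightarrow> 'b) (xs :: nat \<Rightarrow> 'a) x.
        (\<forall>k. xs k \<in> D) \<longrightarrow> weakly_tendsto xs x sequentially \<longrightarrow>
        (\<lambda>k. S (F (xs k)) (ys k)) \<longlonglongrightarrow> 0 \<longrightarrow> (\<lambda>k. S y (ys k)) \<longlonglongrightarrow> 0 \<longrightarrow>
        x \<in> D \<and> F x = y)"

definition variational_source_condition ::
    "'a::real_inner set \<Rightarrow> ('a \<Rightarrow> 'b) \<Rightarrow> ('b \<Rightarrow> 'b \<Rightarrow> real) \<Rightarrow> (real \<Rightarrow> real) \<Rightarrow> 'a \<Rightarrow> real \<Rightarrow> bool"
  where
  "variational_source_condition D F S \<phi> xd R \<longleftrightarrow>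
     (\<exists>\<beta>\<in>{0<..<1}. \<forall>x \<in> ball xd R \<inter> D.
        2 * inner xd (xd - x) \<le> \<beta> * (norm (xd - x))\<^sup>2 + \<phi> (S (F xd) (F x)))"

text \<open>The condition is local: it says nothing about solutions outside the ball, and a radius that is
  too small does not yield convergence rates.  For \<open>F x = (x - 1) * (x - 3)\<close> on the reals,
  \<open>y = 0\<close>, \<open>S u v = \<bar>u - v\<bar>\<close> and exact data, it holds at the solution 3 with
  \<open>R = 1\<close> and \<open>\<phi> t = 6 * t\<close>, while the reconstructions converge to the solution 1 of
  smaller norm.  The rate therefore needs a radius for which the ball contains the reconstructions
  for small \<open>\<delta>\<close>; containing all solutions of norm at most \<open>norm xd\<close> is sufficient for that
  (for example, \<open>R > 2 * norm xd\<close>, or \<open>xd\<close> the only solution).\<close>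

definition generalized_triangle_inequality :: "('b \<Rightarrow> 'b \<Rightarrow> real) \<Rightarrow> real \<Rightarrow> bool" where
  "generalized_triangle_inequality S C \<longleftrightarrow>
     (\<forall>y1 y2 y3. S y1 y2 \<le> C * (S y1 y3 + S y2 y3))"

text \<open>Minimum over an admissible set; it is always used together with the assumption that the
  minimum is attained, so that the infimum is not a junk value.\<close>

definition min_over :: "('a \<Rightarrow> real) \<Rightarrow> 'a set \<Rightarrow> real" where
  "min_over r A = Inf (r ` A)"

definition min_attained :: "('a \<Rightarrow> real) \<Rightarrow> 'a set \<Rightarrow> bool" where
  "min_attained r A \<longleftrightarrow> (\<exists>x. is_arg_min r (\<lambda>z. z \<in> A) x)"

end

theory Submission
  imports Defs "HOL-Complex_Analysis.Great_Picard"
begin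

text \<open>Everything follows from two estimates, valid for every \<open>\<delta> \<in> {0<..\<delta>bar}\<close>:
  \<open>(norm (xh \<delta>))\<^sup>2 \<le> (norm xd)\<^sup>2 + c * \<phi> (C2 * \<delta>)\<close> with \<open>c = C11 + C12\<close>, and
  \<open>S (F (xh \<delta>)) (yd \<delta>) \<le> K * \<delta>\<close> with \<open>K = \<tau> + \<tau>1 + \<tau>2\<close>.  The second is the upper
  half of the discrepancy principle together with the residual tolerances.  The first comes from the
  lower half: if the projected exact solution were admissible for the discrete minimization problem,
  the near-minimizer \<open>xh \<delta>\<close> would have a discrete residual of at most \<open>\<delta> + \<eta>lo \<delta>\<close>
  (\<open>infeasible_if_discrepancy\<close>).  Hence the projection violates the
  norm constraint, so \<open>\<rho> \<delta>\<close> lies below its squared discrete norm, and the two norm comparisons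
  turn this into a bound of \<open>norm (xh \<delta>)\<close> by \<open>norm xd\<close>.

  The norm bound makes every sequence of reconstructions weakly precompact
  (\<open>bounded_seq_weakly_convergent_subseq\<close>), and because the residuals vanish, weak sequential
  closedness makes every weak limit a solution.  Strong convergence then only requires control of the
  norms (\<open>weakly_tendsto_imp_tendsto\<close>).  Statements about \<open>\<delta> \<rightarrow> 0\<close>
  reduce to sequences, since a property that fails frequently near 0 fails along a whole null
  sequence (\<open>eventually_at_right_if_sequences_meet\<close>).

  For the rate, the norm bound gives
  \<open>(norm (xh \<delta> - xd))\<^sup>2 \<le> c * \<phi> (C2 * \<delta>) + 2 * inner xd (xd - xh \<delta>)\<close>, and the
  source condition absorbs the inner product, its residual being controlled by the generalized
  triangle inequality.  This requires that the reconstructions eventually lie in the ball on which the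
  source condition holds.  Suppose that this is only known of the solutions of norm at most
  \<open>norm xd\<close>.  Then a null sequence with reconstructions outside of the ball would have a subsequence with a
  weak limit \<open>x\<close> that is a solution with \<open>norm x \<le> norm xd\<close>, hence in the ball; the
  source condition at \<open>x\<close> itself then forces \<open>x = xd\<close>, so the norm bound upgrades weak to strong
  convergence to the centre of the ball, a contradiction.\<close>

section \<open>Weak sequential compactness in Hilbert space\<close>

text \<open>This replaces weak compactness of balls: points of almost minimal norm in the sets form a
  Cauchy sequence.  Indeed the minimal norms increase to a finite limit, while for \<open>k \<le> j\<close> the
  midpoint of the points chosen from \<open>C k\<close> and \<open>C j\<close> still lies in \<open>C k\<close>, so the
  parallelogram identity bounds their distance.\<close>

lemma convex_seq_closures_intersect:
  fixes C :: "nat \<Rightarrow> 'a::{real_inner, complete_space} set"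
  assumes dec: "\<And>i j. i \<le> j \<Longrightarrow> C j \<subseteq> C i"
    and convex: "\<And>k. convex (C k)"
    and nonempty: "\<And>k. C k \<noteq> {}"
    and bounded: "bounded (C 0)"
  obtains z where "\<And>k. z \<in> closure (C k)"
proof -
  define m where "m k = Inf ((\<lambda>x. (norm x)\<^sup>2) ` C k)" for k
  have bdd: "bdd_below ((\<lambda>x. (norm x)\<^sup>2) ` C k)" for k
    by (rule bdd_belowI[of _ 0]) auto
  have m_le: "m k \<le> (norm x)\<^sup>2" if "x \<in> C k" for k x
    unfolding m_def using bdd that by (intro cInf_lower) auto
  have m_mono: "m i \<le> m j" if "i \<le> j" for i j
    unfolding m_def using bdd nonempty dec[OF that] by (intro cInf_superset_mono) auto
  obtain M where M: "\<And>x. x \<in> C 0 \<Longrightarrow> norm x \<le> M"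
    using bounded unfolding bounded_iff by blast
  have m_le_M: "m k \<le> M\<^sup>2" for k
  proof -
    obtain x where "x \<in> C k" using nonempty by blast
    with m_le M dec[of 0 k] show ?thesis
      by (smt (verit) norm_ge_zero power_mono subsetD zero_le)
  qed
  obtain l where l: "m \<longlonglongrightarrow> l" and m_le_l: "\<And>k. m k \<le> l"
    using incseq_convergent[of m "M\<^sup>2"] m_mono m_le_M unfolding incseq_def by blast
  have "\<exists>x\<in>C k. (norm x)\<^sup>2 < m k + inverse (real (Suc k))" for k
  proof -
    have "\<exists>t\<in>(\<lambda>x. (norm x)\<^sup>2) ` C k. t < m k + inverse (real (Suc k))"
      using cInf_lessD[of "(\<lambda>x. (norm x)\<^sup>2) ` C k" "m k + inverse (real (Suc k))"] nonempty
      unfolding m_def by auto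
    then show ?thesis by blast
  qed
  then obtain z where zC: "\<And>k. z k \<in> C k"
    and z_less: "\<And>k. (norm (z k))\<^sup>2 < m k + inverse (real (Suc k))"
    by metis
  define b where "b k = 2 * (l - m k) + 4 * inverse (real (Suc k))" for k
  have b: "b \<longlonglongrightarrow> 2 * (l - l) + 4 * 0"
    unfolding b_def by (intro tendsto_intros l LIMSEQ_inverse_real_of_nat)
  have dist_z: "(norm (z k - z j))\<^sup>2 \<le> b k" if "k \<le> j" for k j
  proof -
    have "(1/2) *\<^sub>R z k + (1/2) *\<^sub>R z j \<in> C k"
      using convexD[OF convex, of "z k" k "z j" "1/2" "1/2"] zC dec[OF that] by auto
    then have mid: "4 * m k \<le> (norm (z k + z j))\<^sup>2"
      using m_le[of "(1/2) *\<^sub>R z k + (1/2) *\<^sub>R z j" k]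
      by (simp add: scaleR_add_right[symmetric] power_divide)
    have par: "(norm (z k - z j))\<^sup>2 = 2 * (norm (z k))\<^sup>2 + 2 * (norm (z j))\<^sup>2 - (norm (z k + z j))\<^sup>2"
      by (simp add: power2_norm_eq_inner inner_simps inner_commute)
    have "inverse (real (Suc j)) \<le> inverse (real (Suc k))"
      using that by (intro le_imp_inverse_le) auto
    then show ?thesis
      unfolding b_def using mid par z_less[of k] z_less[of j] m_le_l[of j]
      by (simp only:) argo
  qed
  have "Cauchy z"
    unfolding Cauchy_altdef
  proof safe
    fix e :: real assume "0 < e"
    then have "eventually (\<lambda>k. b k < e\<^sup>2) sequentially"
      using b by (intro order_tendstoD(2)[of b 0]) auto
    then obtain k0 where k0: "\<And>k. k \<ge> k0 \<Longrightarrow> b k < e\<^sup>2"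
      unfolding eventually_sequentially by blast
    have "dist (z k) (z j) < e" if "k \<ge> k0" "j > k" for k j
      using dist_z[of k j] k0[of k] that \<open>0 < e\<close>
      by (auto simp: dist_norm intro: power_less_imp_less_base[of _ 2])
    then show "\<exists>M. \<forall>k\<ge>M. \<forall>j>k. dist (z k) (z j) < e" by blast
  qed
  then obtain w where w: "z \<longlonglongrightarrow> w"
    using convergent_eq_Cauchy by blast
  have "w \<in> closure (C k)" for k
  proof (rule Lim_in_closed_set[OF closed_closure _ _ w])
    show "eventually (\<lambda>j. z j \<in> closure (C k)) sequentially"
      using zC dec closure_subset eventually_sequentially by (metis in_mono)
  qed auto
  then show thesis by (rule that)
qed

text \<open>A point in the closed convex hulls of all tails of the sequence has this property.\<close>

lemma bounded_seq_halfspace_point: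
  fixes u :: "nat \<Rightarrow> 'a::{real_inner, complete_space}"
  assumes "bounded (range u)"
  obtains z where "\<And>(f::'a \<Rightarrow> real) c. bounded_linear f \<Longrightarrow> \<forall>\<^sub>F k in sequentially. c \<le> f (u k) \<Longrightarrow> c \<le> f z"
proof -
  define C where "C k = convex hull (u ` {k..})" for k
  obtain z where z: "\<And>k. z \<in> closure (C k)"
  proof (rule convex_seq_closures_intersect[of C])
    show "C j \<subseteq> C i" if "i \<le> j" for i j
      unfolding C_def using that by (intro hull_mono) auto
    show "bounded (C 0)"
      unfolding C_def using bounded_convex_hull assms by (simp add: atLeast_0)
  qed (auto simp: C_def)
  show thesis
  proof (rule that)
    fix f :: "'a \<Rightarrow> real" and c
    assume f: "bounded_linear f" and "\<forall>\<^sub>F k in sequentially. c \<le> f (u k)"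
    then obtain k where k: "\<And>j. j \<ge> k \<Longrightarrow> c \<le> f (u j)"
      unfolding eventually_sequentially by blast
    let ?H = "f -` {c..}"
    have "convex ?H"
      using f by (intro convex_linear_vimage bounded_linear.linear) auto
    moreover have "closed ?H"
      using f by (intro closed_vimage linear_continuous_on) auto
    ultimately have "closure (C k) \<subseteq> ?H"
      unfolding C_def using k by (intro closure_minimal hull_minimal) auto
    with z show "c \<le> f z" by auto
  qed
qed

text \<open>A diagonal argument makes the inner products with each member of the sequence converge along
  a subsequence \<open>u \<circ> s\<close>.  These limits determine the point that the preceding lemma attaches to
  \<open>u \<circ> s\<close> or to any further subsequence: two such points have the same inner product with every
  \<open>u m\<close>, and by the half-space property a vector orthogonal to all \<open>u m\<close> is orthogonal to the
  two points as well, so that their difference is orthogonal to itself.  If \<open>f \<circ> u \<circ> s\<close> stayed away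
  from \<open>f z\<close> along a further subsequence, the point of that subsequence would differ from
  \<open>z\<close>.  The argument applies to an arbitrary bounded functional \<open>f\<close> directly, without
  representing it as an inner product.\<close>

lemma bounded_seq_weakly_convergent_subseq:
  fixes u :: "nat \<Rightarrow> 'a::{real_inner, complete_space}"
  assumes bdd: "bounded (range u)"
  obtains z s where "strict_mono (s :: nat \<Rightarrow> nat)" "weakly_tendsto (u \<circ> s) z sequentially"
proof -
  obtain M where M: "\<And>k. norm (u k) \<le> M"
    using bdd unfolding bounded_iff by auto
  have "norm (inner (u m) (u k)) \<le> M * M" for m k
  proof -
    have "norm (inner (u m) (u k)) \<le> norm (u m) * norm (u k)"
      using Cauchy_Schwarz_ineq2 by auto
    also have "\<dots> \<le> M * M"
      using M norm_ge_zero order_trans by (intro mult_mono) blast+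
    finally show ?thesis .
  qed
  then obtain s :: "nat \<Rightarrow> nat" where s: "strict_mono s"
    and "\<And>m. \<exists>l. (\<lambda>k. inner (u m) (u (s k))) \<longlonglongrightarrow> l"
    using function_convergent_subsequence[of UNIV "\<lambda>k m. inner (u m) (u k)" "M * M"]
    by (metis UNIV_I countableI_type)
  then obtain l where l: "\<And>m. (\<lambda>k. inner (u m) (u (s k))) \<longlonglongrightarrow> l m"
    by metis
  define in_halfspaces where "in_halfspaces r z \<longleftrightarrow>
    (\<forall>f::'a \<Rightarrow> real. \<forall>c. bounded_linear f \<longrightarrow> (\<forall>\<^sub>F k in sequentially. c \<le> f (u (r k))) \<longrightarrow> c \<le> f z)"
    for r :: "nat \<Rightarrow> nat" and z
  have ex: "\<exists>z. in_halfspaces r z" for r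
  proof -
    have "bounded (range (\<lambda>k. u (r k)))"
      by (rule bounded_subset[OF bdd]) auto
    then show ?thesis
      unfolding in_halfspaces_def using bounded_seq_halfspace_point by metis
  qed
  obtain z where z: "in_halfspaces s z" using ex by blast
  have inner_z: "inner (u m) w = l m" if t: "strict_mono t" and w: "in_halfspaces (s \<circ> t) w" for t w m
  proof (rule antisym)
    have lt: "(\<lambda>k. inner (u m) (u ((s \<circ> t) k))) \<longlonglongrightarrow> l m"
      using LIMSEQ_subseq_LIMSEQ[OF l t] by (simp add: o_def)
    show "l m \<le> inner (u m) w"
    proof (rule field_le_epsilon)
      fix e :: real assume "0 < e"
      then have "\<forall>\<^sub>F k in sequentially. l m - e \<le> inner (u m) (u ((s \<circ> t) k))"
        using order_tendstoD(1)[OF lt, of "l m - e"] by (auto elim: eventually_mono)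
      then have "l m - e \<le> inner (u m) w"
        using w bounded_linear_inner_right unfolding in_halfspaces_def by blast
      then show "l m \<le> inner (u m) w + e" by simp
    qed
    show "inner (u m) w \<le> l m"
    proof (rule field_le_epsilon)
      fix e :: real assume "0 < e"
      then have "\<forall>\<^sub>F k in sequentially. - l m - e \<le> - inner (u m) (u ((s \<circ> t) k))"
        using order_tendstoD(2)[OF lt, of "l m + e"] by (auto elim: eventually_mono)
      moreover have "bounded_linear (\<lambda>x. - inner (u m) x)"
        by (intro bounded_linear_minus bounded_linear_inner_right)
      ultimately have "- l m - e \<le> - inner (u m) w"
        using w unfolding in_halfspaces_def by blast
      then show "inner (u m) w \<le> l m + e" by simp
    qed
  qed
  have unique: "w = z" if t: "strict_mono t" and w: "in_halfspaces (s \<circ> t) w" for t w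
  proof -
    have diff0: "inner (u m) (w - z) = 0" for m
      using inner_z[OF t w] inner_z[of id z] z by (simp add: inner_diff_right strict_mono_id)
    have zero: "inner v (w - z) = 0" if v: "in_halfspaces r v" for r v
    proof -
      have "0 \<le> inner v (w - z)"
        using v bounded_linear_inner_left[of "w - z"] unfolding in_halfspaces_def
        by (auto simp: diff0)
      moreover have "0 \<le> inner v (z - w)"
        using v bounded_linear_inner_left[of "z - w"] diff0 unfolding in_halfspaces_def
        by (metis (mono_tags, lifting) always_eventually inner_minus_right minus_diff_eq neg_0_equal_iff_equal order_refl)
      ultimately show ?thesis by (simp add: inner_diff_right)
    qed
    have "inner (w - z) (w - z) = 0"
      using zero[OF w] zero[OF z] by (simp add: inner_diff_left)
    then show "w = z" by simp
  qed
  have above: "\<forall>\<^sub>F k in sequentially. f (u (s k)) < f z + e" if f: "bounded_linear f" and "0 < e" for f :: "'a \<Rightarrow> real" and e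
  proof (rule ccontr)
    assume "\<not> ?thesis"
    then obtain t :: "nat \<Rightarrow> nat" where t: "strict_mono t"
      and ft: "\<And>k. f z + e \<le> f (u (s (t k)))"
      using not_eventually_sequentiallyD by (metis not_less)
    obtain w where w: "in_halfspaces (s \<circ> t) w" using ex by blast
    then have "f z + e \<le> f w"
      using f ft unfolding in_halfspaces_def by simp
    with unique[OF t w] \<open>0 < e\<close> show False by simp
  qed
  have "((\<lambda>k. f (u (s k))) \<longlongrightarrow> f z) sequentially" if f: "bounded_linear f" for f :: "'a \<Rightarrow> real"
  proof (rule order_tendstoI)
    fix a assume "f z < a"
    then show "\<forall>\<^sub>F k in sequentially. f (u (s k)) < a"
      using above[OF f, of "a - f z"] by simp
  next
    fix a assume "a < f z"
    then show "\<forall>\<^sub>F k in sequentially. a < f (u (s k))"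
      using above[OF bounded_linear_minus[OF f], of "f z - a"] by (auto elim: eventually_mono)
  qed
  then show thesis
    using that[OF s, of z] by (simp add: weakly_tendsto_def)
qed

section \<open>Norms under weak convergence\<close>

lemma weakly_tendsto_inner:
  fixes x :: "'a::real_inner"
  assumes "weakly_tendsto u x G"
  shows "((\<lambda>t. inner (u t) v) \<longlongrightarrow> inner x v) G"
  using assms bounded_linear_inner_left unfolding weakly_tendsto_def by blast

text \<open>The squared norm is weakly lower semicontinuous, being the supremum of the affine functions
  \<open>\<lambda>v. 2 * inner v x - (norm x)\<^sup>2\<close>; the one that touches it at the limit suffices.\<close>

lemma weak_limit_norm_le:
  fixes x :: "'a::real_inner"
  assumes weak: "weakly_tendsto u x G" and "G \<noteq> bot"
    and le: "\<forall>\<^sub>F t in G. (norm (u t))\<^sup>2 \<le> b t" and b: "(b \<longlongrightarrow> B) G"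
  shows "(norm x)\<^sup>2 \<le> B"
proof -
  have ineq: "2 * inner (u t) x - (norm x)\<^sup>2 \<le> (norm (u t))\<^sup>2" for t
    using inner_ge_zero[of "u t - x"]
    by (simp add: power2_norm_eq_inner inner_simps inner_commute)
  have "((\<lambda>t. 2 * inner (u t) x - (norm x)\<^sup>2) \<longlongrightarrow> 2 * inner x x - (norm x)\<^sup>2) G"
    by (intro tendsto_intros weakly_tendsto_inner weak)
  then have "2 * inner x x - (norm x)\<^sup>2 \<le> B"
    by (rule tendsto_le[OF \<open>G \<noteq> bot\<close> b]) (use le ineq in \<open>auto elim!: eventually_mono intro: order_trans\<close>)
  then show ?thesis by (simp add: power2_norm_eq_inner)
qed

text \<open>The Radon--Riesz property: in the expansion of \<open>(norm (u t - x))\<^sup>2\<close> weak convergence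
  settles the inner product, and only the norms remain.\<close>

lemma weakly_tendsto_imp_tendsto:
  fixes x :: "'a::real_inner"
  assumes weak: "weakly_tendsto u x G"
    and limsup: "Limsup G (\<lambda>t. ereal ((norm (u t))\<^sup>2)) \<le> ereal ((norm x)\<^sup>2)"
  shows "(u \<longlongrightarrow> x) G"
proof -
  have expand: "(norm (u t - x))\<^sup>2 = (norm (u t))\<^sup>2 - 2 * inner (u t) x + (norm x)\<^sup>2" for t
    by (simp add: power2_norm_eq_inner inner_simps inner_commute)
  have lim: "((\<lambda>t. inner (u t) x) \<longlongrightarrow> (norm x)\<^sup>2) G"
    using weakly_tendsto_inner[OF weak] by (simp add: power2_norm_eq_inner)
  show ?thesis
  proof (rule tendstoI)
    fix e :: real assume "0 < e"
    then have e: "0 < e\<^sup>2" by simp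
    have "\<forall>\<^sub>F t in G. ereal ((norm (u t))\<^sup>2) < ereal ((norm x)\<^sup>2 + e\<^sup>2 / 2)"
      using limsup e by (intro Limsup_lessD) (auto intro: le_less_trans)
    moreover have "\<forall>\<^sub>F t in G. (norm x)\<^sup>2 - e\<^sup>2 / 4 < inner (u t) x"
      using order_tendstoD(1)[OF lim] e by simp
    ultimately have "\<forall>\<^sub>F t in G. (norm (u t - x))\<^sup>2 < e\<^sup>2"
      by eventually_elim (simp add: expand)
    then show "\<forall>\<^sub>F t in G. dist (u t) x < e"
      by eventually_elim (use \<open>0 < e\<close> in \<open>auto simp: dist_norm intro: power_less_imp_less_base[of _ 2]\<close>)
  qed
qed

section \<open>Limits as the noise level tends to zero\<close>

text \<open>One good index per null sequence is enough, since a property that is not eventually true fails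
  on all members of some null sequence.  This is what compactness provides: it yields good behaviour
  only along a subsequence.\<close>

lemma eventually_at_right_if_sequences_meet:
  fixes a b :: real
  assumes "a < b"
    and meet: "\<And>f. (\<And>k. f k \<in> {a<..b}) \<Longrightarrow> f \<longlonglongrightarrow> a \<Longrightarrow> \<exists>k::nat. Q (f k)"
  shows "\<forall>\<^sub>F t in at_right a. Q t"
proof (rule sequentially_imp_eventually_at_right[OF \<open>a < b\<close>], rule ccontr)
  fix f :: "nat \<Rightarrow> real"
  assume f: "\<And>n. a < f n" "\<And>n. f n < b" "f \<longlonglongrightarrow> a"
    and "\<not> (\<forall>\<^sub>F n in sequentially. Q (f n))"
  then obtain s :: "nat \<Rightarrow> nat" where "strict_mono s" "\<And>k. \<not> Q (f (s k))"
    using not_eventually_sequentiallyD by metis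
  with f meet[of "f \<circ> s"] show False
    by (auto simp: less_imp_le LIMSEQ_subseq_LIMSEQ)
qed

lemma index_function_at_0:
  assumes "index_function \<phi>" shows "\<phi> 0 = 0"
proof (rule antisym)
  have "(\<phi> \<longlongrightarrow> 0) (at_right 0)" and mono: "mono_on {0..} \<phi>"
    using assms by (auto simp: index_function_def)
  then show "\<phi> 0 \<le> 0"
  proof (intro tendsto_lowerbound[of \<phi> 0 "at_right 0"])
    show "\<forall>\<^sub>F t in at_right 0. \<phi> 0 \<le> \<phi> t"
      using mono by (auto simp: eventually_at_filter mono_on_def)
  qed auto
  show "0 \<le> \<phi> 0" using assms by (auto simp: index_function_def)
qed

lemma index_function_scaled:
  assumes "index_function \<phi>" and "0 < c"
  shows "((\<lambda>t. \<phi> (c * t)) \<longlongrightarrow> 0) (at_right 0)"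
proof -
  have "((\<lambda>t. c * t) \<longlongrightarrow> c * 0) (at_right 0)"
    by (intro tendsto_intros)
  then have "filterlim (\<lambda>t. c * t) (at_right 0) (at_right 0)"
    using \<open>0 < c\<close> by (auto simp: filterlim_at eventually_at_filter)
  then show ?thesis
    using assms filterlim_compose by (auto simp: index_function_def)
qed

section \<open>The discrepancy principle\<close>

text \<open>The step that turns the lower discrepancy bound into a norm bound.  Comparing the near-minimizer
  \<open>x\<close> with an admissible \<open>p\<close> would give \<open>r x \<le> r p + \<eta> \<le> c + \<eta>lo\<close>.  Attainment of the
  minimum enters because it makes the infimum a genuine lower bound.\<close>

lemma infeasible_if_discrepancy:
  assumes attained: "min_attained r A"
    and min: "r x \<le> min_over r A + \<eta>"
    and lower: "c + \<eta>lo < r x" and "r p - c \<le> \<eta>lo - \<eta>"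
  shows "p \<notin> A"
proof
  assume "p \<in> A"
  obtain q where "\<And>z. z \<in> A \<Longrightarrow> r q \<le> r z"
    using attained by (auto simp: min_attained_def is_arg_min_linorder)
  then have "bdd_below (r ` A)" by (intro bdd_belowI2)
  with \<open>p \<in> A\<close> have "min_over r A \<le> r p"
    unfolding min_over_def by (intro cInf_lower) auto
  with assms show False by linarith
qed

section \<open>Convergence and convergence rates\<close>

theorem corollary2p5:
  fixes D :: "'a::{real_inner, complete_space} set"
    and F :: "'a \<Rightarrow> 'b::banach"
    and S :: "'b \<Rightarrow> 'b \<Rightarrow> real"
    and X :: "nat \<Rightarrow> 'a set"
    and N :: "nat \<Rightarrow> 'a \<Rightarrow> real"
    and P :: "nat \<Rightarrow> 'a \<Rightarrow> 'a"
    and Fn :: "nat \<Rightarrow> 'a \<Rightarrow> 'b"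
    and Sn :: "nat \<Rightarrow> 'b \<Rightarrow> 'b \<Rightarrow> real"
    and y :: 'b and yd :: "real \<Rightarrow> 'b"
    and xd :: 'a and xh :: "real \<Rightarrow> 'a"
    and \<phi> :: "real \<Rightarrow> real"
    and n :: "real \<Rightarrow> nat"
    and \<rho> \<eta> \<eta>lo \<eta>up :: "real \<Rightarrow> real"
    and \<delta>bar \<tau> \<tau>1 \<tau>2 C11 C12 C2 :: real
    and r :: "real \<Rightarrow> 'a \<Rightarrow> real"
    and rn :: "nat \<Rightarrow> real \<Rightarrow> 'a \<Rightarrow> real"
  defines "r \<equiv> \<lambda>\<delta> x. S (F x) (yd \<delta>)"
    and "rn \<equiv> \<lambda>m \<delta> x. Sn m (Fn m x) (yd \<delta>)"
  assumes S_nonneg: "\<And>u v. 0 \<le> S u v"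
    and X_subspace: "\<And>m. finite_dim_subspace (X m)"
    and N_norm: "\<And>m. norm_on_by_inner_product (X m) (N m)"
    and P_proj: "\<And>m. orthogonal_projection_onto (X m) (P m)"
    and attained: "\<And>m \<delta> \<sigma>. \<delta> \<in> {0<..\<delta>bar} \<Longrightarrow> 0 \<le> \<sigma> \<Longrightarrow>
          min_attained (rn m \<delta>) {x \<in> X m. (N m x)\<^sup>2 \<le> \<sigma>}"
    and xd: "xd \<in> D" "F xd = y"
    and \<delta>bar: "0 < \<delta>bar" and \<tau>: "1 < \<tau>"
    and noise: "\<And>\<delta>. \<delta> \<in> {0<..\<delta>bar} \<Longrightarrow> S y (yd \<delta>) \<le> \<delta>"
    and closed: "weakly_seq_closed_at D F S y"
    and \<phi>: "index_function \<phi>"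
    and const_pos: "0 < \<tau>1" "0 < \<tau>2" "0 < C11" "0 < C12" "0 < C2"
    and \<rho>_nonneg: "\<And>\<delta>. \<delta> \<in> {0<..\<delta>bar} \<Longrightarrow> 0 \<le> \<rho> \<delta>"
    and xh_mem: "\<And>\<delta>. \<delta> \<in> {0<..\<delta>bar} \<Longrightarrow> xh \<delta> \<in> X (n \<delta>) \<inter> D"
    and xh_feasible: "\<And>\<delta>. \<delta> \<in> {0<..\<delta>bar} \<Longrightarrow> (N (n \<delta>) (xh \<delta>))\<^sup>2 \<le> \<rho> \<delta>"
    and xh_minimal: "\<And>\<delta>. \<delta> \<in> {0<..\<delta>bar} \<Longrightarrow>
          rn (n \<delta>) \<delta> (xh \<delta>)
            \<le> min_over (rn (n \<delta>) \<delta>) {x \<in> X (n \<delta>). (N (n \<delta>) x)\<^sup>2 \<le> \<rho> \<delta>} + \<eta> \<delta>"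
    and discrepancy_lower: "\<And>\<delta>. \<delta> \<in> {0<..\<delta>bar} \<Longrightarrow> \<delta> + \<eta>lo \<delta> < rn (n \<delta>) \<delta> (xh \<delta>)"
    and discrepancy_upper: "\<And>\<delta>. \<delta> \<in> {0<..\<delta>bar} \<Longrightarrow> rn (n \<delta>) \<delta> (xh \<delta>) \<le> \<tau> * \<delta> + \<eta>up \<delta>"
    and \<eta>_nonneg: "\<And>\<delta>. \<delta> \<in> {0<..\<delta>bar} \<Longrightarrow> 0 \<le> \<eta> \<delta>"
    and \<eta>lo_less: "\<And>\<delta>. \<delta> \<in> {0<..\<delta>bar} \<Longrightarrow> \<eta>lo \<delta> < (\<tau> - 1) * \<delta> + \<eta>up \<delta>"
    and \<eta>lo_ge: "\<And>\<delta>. \<delta> \<in> {0<..\<delta>bar} \<Longrightarrow>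
          \<eta>lo \<delta> - \<eta> \<delta> \<ge> rn (n \<delta>) \<delta> (P (n \<delta>) xd) - r \<delta> xd"
    and norm_xd: "\<And>\<delta>. \<delta> \<in> {0<..\<delta>bar} \<Longrightarrow>
          (N (n \<delta>) (P (n \<delta>) xd))\<^sup>2 - (norm xd)\<^sup>2 \<le> C11 * \<phi> (C2 * \<delta>)"
    and norm_xh: "\<And>\<delta>. \<delta> \<in> {0<..\<delta>bar} \<Longrightarrow>
          (norm (xh \<delta>))\<^sup>2 - (N (n \<delta>) (xh \<delta>))\<^sup>2 \<le> C12 * \<phi> (C2 * \<delta>)"
    and residual_error: "\<And>\<delta>. \<delta> \<in> {0<..\<delta>bar} \<Longrightarrow>
          r \<delta> (xh \<delta>) - rn (n \<delta>) \<delta> (xh \<delta>) \<le> \<tau>1 * \<delta>"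
    and \<eta>up_le: "\<And>\<delta>. \<delta> \<in> {0<..\<delta>bar} \<Longrightarrow> \<eta>up \<delta> \<le> \<tau>2 * \<delta>"
  shows
    "(\<exists>\<delta>k x. (\<forall>k. \<delta>k k \<in> {0<..\<delta>bar}) \<and> \<delta>k \<longlonglongrightarrow> 0 \<and>
        weakly_tendsto (\<lambda>k::nat. xh (\<delta>k k)) x sequentially) \<and>
     (\<forall>\<delta>k x. (\<forall>k. \<delta>k k \<in> {0<..\<delta>bar}) \<and> \<delta>k \<longlonglongrightarrow> 0 \<and>
        weakly_tendsto (\<lambda>k::nat. xh (\<delta>k k)) x sequentially \<longrightarrow>
        x \<in> D \<and> F x = y \<and>
        (limsup (\<lambda>k. ereal ((norm (xh (\<delta>k k)))\<^sup>2)) \<le> ereal ((norm x)\<^sup>2) \<longrightarrow>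
           (\<lambda>k. xh (\<delta>k k)) \<longlonglongrightarrow> x)) \<and>
     ((\<forall>x\<in>D. F x = y \<longrightarrow> x = xd) \<longrightarrow>
        weakly_tendsto xh xd (at_right 0) \<and>
        (Limsup (at_right 0) (\<lambda>\<delta>. ereal ((norm (xh \<delta>))\<^sup>2)) \<le> ereal ((norm xd)\<^sup>2) \<longrightarrow>
           (xh \<longlongrightarrow> xd) (at_right 0))) \<and>
     (\<forall>R C4. 0 < R \<and> 0 < C4 \<and>
        variational_source_condition D F S \<phi> xd R \<and>
        generalized_triangle_inequality S C4 \<and>
        ((\<forall>x\<in>D. F x = y \<and> norm x \<le> norm xd \<longrightarrow> x \<in> ball xd R) \<or>
         (\<forall>\<^sub>F \<delta> in at_right 0. xh \<delta> \<in> ball xd R)) \<longrightarrow>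
        (\<lambda>\<delta>. (norm (xh \<delta> - xd))\<^sup>2)
          \<in> O[at_right 0](\<lambda>\<delta>. \<phi> (max C2 (C4 * (\<tau> + \<tau>1 + \<tau>2 + 1)) * \<delta>)))"
proof -
  define c where "c = C11 + C12"
  define K where "K = \<tau> + \<tau>1 + \<tau>2"
  have c: "0 < c" and K: "0 < K"
    using const_pos \<tau> by (auto simp: c_def K_def)
  have \<phi>_nonneg: "\<And>t. 0 \<le> t \<Longrightarrow> 0 \<le> \<phi> t"
    and \<phi>_mono: "\<And>s t. 0 \<le> s \<Longrightarrow> s \<le> t \<Longrightarrow> \<phi> s \<le> \<phi> t"
    using \<phi> by (auto simp: index_function_def mono_on_def)
  have P_mem: "P m x \<in> X m" for m x
    using P_proj by (auto simp: orthogonal_projection_onto_def)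

  have norm_bound: "(norm (xh \<delta>))\<^sup>2 \<le> (norm xd)\<^sup>2 + c * \<phi> (C2 * \<delta>)" if \<delta>: "\<delta> \<in> {0<..\<delta>bar}" for \<delta>
  proof -
    have "P (n \<delta>) xd \<notin> {x \<in> X (n \<delta>). (N (n \<delta>) x)\<^sup>2 \<le> \<rho> \<delta>}"
    proof (rule infeasible_if_discrepancy)
      show "min_attained (rn (n \<delta>) \<delta>) {x \<in> X (n \<delta>). (N (n \<delta>) x)\<^sup>2 \<le> \<rho> \<delta>}"
        using attained \<rho>_nonneg \<delta> by blast
      show "rn (n \<delta>) \<delta> (P (n \<delta>) xd) - \<delta> \<le> \<eta>lo \<delta> - \<eta> \<delta>"
        using \<eta>lo_ge[OF \<delta>] noise[OF \<delta>] xd(2) by (simp add: r_def)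
    qed (use xh_minimal discrepancy_lower \<delta> in auto)
    then have "\<rho> \<delta> < (N (n \<delta>) (P (n \<delta>) xd))\<^sup>2"
      using P_mem by auto
    with norm_xd[OF \<delta>] norm_xh[OF \<delta>] xh_feasible[OF \<delta>] show ?thesis
      unfolding c_def distrib_right by linarith
  qed
  have residual_bound: "S (F (xh \<delta>)) (yd \<delta>) \<le> K * \<delta>" if \<delta>: "\<delta> \<in> {0<..\<delta>bar}" for \<delta>
    using residual_error[OF \<delta>] discrepancy_upper[OF \<delta>] \<eta>up_le[OF \<delta>]
    by (simp add: r_def K_def distrib_right)
  have xh_D: "xh \<delta> \<in> D" if "\<delta> \<in> {0<..\<delta>bar}" for \<delta>
    using xh_mem[OF that] by blast

  have bound_tendsto: "((\<lambda>\<delta>. (norm xd)\<^sup>2 + c * \<phi> (C2 * \<delta>)) \<longlongrightarrow> (norm xd)\<^sup>2 + c * 0) (at_right 0)"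
    by (intro tendsto_intros index_function_scaled \<phi> const_pos)
  have bound_seq: "(\<lambda>k. (norm xd)\<^sup>2 + c * \<phi> (C2 * \<delta>k k)) \<longlonglongrightarrow> (norm xd)\<^sup>2"
    if "\<And>k. \<delta>k k \<in> {0<..\<delta>bar}" "\<delta>k \<longlonglongrightarrow> 0" for \<delta>k :: "nat \<Rightarrow> real"
  proof -
    have "\<And>k. 0 < \<delta>k k \<and> \<delta>k k \<noteq> 0"
      using that(1) by (metis greaterThanAtMost_iff less_irrefl)
    then have "filterlim \<delta>k (at_right 0) sequentially"
      using that(2) by (simp add: filterlim_at)
    with bound_tendsto show ?thesis
      by (auto dest: filterlim_compose)
  qed

  have limit_solves: "x \<in> D \<and> F x = y"
    if \<delta>k: "\<And>k. \<delta>k k \<in> {0<..\<delta>bar}" "\<delta>k \<longlonglongrightarrow> 0"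
      and weak: "weakly_tendsto (\<lambda>k. xh (\<delta>k k)) x sequentially" for \<delta>k :: "nat \<Rightarrow> real" and x
  proof -
    have "(\<lambda>k. S y (yd (\<delta>k k))) \<longlonglongrightarrow> 0"
      by (rule tendsto_sandwich[OF _ _ tendsto_const \<delta>k(2)])
        (use S_nonneg noise \<delta>k(1) in auto)
    moreover have "(\<lambda>k. S (F (xh (\<delta>k k))) (yd (\<delta>k k))) \<longlonglongrightarrow> 0"
    proof (rule tendsto_sandwich[OF _ _ tendsto_const])
      show "(\<lambda>k. K * \<delta>k k) \<longlonglongrightarrow> 0"
        using tendsto_mult_right_zero[OF \<delta>k(2)] .
    qed (use S_nonneg residual_bound \<delta>k(1) in auto)
    ultimately show ?thesis
      using closed weak xh_D \<delta>k(1) unfolding weakly_seq_closed_at_def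
      by (elim allE[of _ "\<lambda>k. yd (\<delta>k k)"] allE[of _ "\<lambda>k. xh (\<delta>k k)"] allE[of _ x]) auto
  qed

  have subseq: "\<exists>s x. strict_mono (s :: nat \<Rightarrow> nat) \<and> weakly_tendsto (\<lambda>k. xh (\<delta>k (s k))) x sequentially"
    if \<delta>k: "\<And>k. \<delta>k k \<in> {0<..\<delta>bar}" for \<delta>k :: "nat \<Rightarrow> real"
  proof -
    have "norm (xh (\<delta>k k)) \<le> sqrt ((norm xd)\<^sup>2 + c * \<phi> (C2 * \<delta>bar))" for k
    proof (rule real_le_rsqrt)
      have "\<phi> (C2 * \<delta>k k) \<le> \<phi> (C2 * \<delta>bar)"
        using \<delta>k[of k] const_pos by (intro \<phi>_mono) auto
      then show "(norm (xh (\<delta>k k)))\<^sup>2 \<le> (norm xd)\<^sup>2 + c * \<phi> (C2 * \<delta>bar)"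
        using norm_bound[OF \<delta>k[of k]] c by (smt (verit) mult_left_mono)
    qed
    then have "bounded (range (\<lambda>k. xh (\<delta>k k)))"
      unfolding bounded_iff by blast
    then show ?thesis
      by (rule bounded_seq_weakly_convergent_subseq) (auto simp: o_def)
  qed

  have part1: "\<exists>\<delta>k x. (\<forall>k. \<delta>k k \<in> {0<..\<delta>bar}) \<and> \<delta>k \<longlonglongrightarrow> 0 \<and>
        weakly_tendsto (\<lambda>k::nat. xh (\<delta>k k)) x sequentially"
  proof -
    define d where "d k = \<delta>bar * inverse (real (Suc k))" for k
    have d: "d k \<in> {0<..\<delta>bar}" for k
      using \<delta>bar by (auto simp: d_def field_simps)
    have "d \<longlonglongrightarrow> \<delta>bar * 0"
      unfolding d_def by (intro tendsto_intros LIMSEQ_inverse_real_of_nat)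
    moreover obtain s x where s: "strict_mono s" "weakly_tendsto (\<lambda>k. xh (d (s k))) x sequentially"
      using subseq[of d, OF d] by blast
    ultimately have "(\<forall>k. (d \<circ> s) k \<in> {0<..\<delta>bar}) \<and> (d \<circ> s) \<longlonglongrightarrow> 0 \<and>
        weakly_tendsto (\<lambda>k. xh ((d \<circ> s) k)) x sequentially"
      using d LIMSEQ_subseq_LIMSEQ[of d 0 s] by auto
    then show ?thesis by blast
  qed

  have part2: "\<forall>\<delta>k x. (\<forall>k. \<delta>k k \<in> {0<..\<delta>bar}) \<and> \<delta>k \<longlonglongrightarrow> 0 \<and>
        weakly_tendsto (\<lambda>k::nat. xh (\<delta>k k)) x sequentially \<longrightarrow>
        x \<in> D \<and> F x = y \<and>
        (limsup (\<lambda>k. ereal ((norm (xh (\<delta>k k)))\<^sup>2)) \<le> ereal ((norm x)\<^sup>2) \<longrightarrow>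
           (\<lambda>k. xh (\<delta>k k)) \<longlonglongrightarrow> x)"
    using limit_solves weakly_tendsto_imp_tendsto by blast

  have weak_xd: "weakly_tendsto xh xd (at_right 0)"
    if unique: "\<forall>x\<in>D. F x = y \<longrightarrow> x = xd"
    unfolding weakly_tendsto_def
  proof (intro allI impI tendstoI)
    fix f :: "'a \<Rightarrow> real" and e :: real
    assume f: "bounded_linear f" and "0 < e"
    show "\<forall>\<^sub>F \<delta> in at_right 0. dist (f (xh \<delta>)) (f xd) < e"
    proof (rule eventually_at_right_if_sequences_meet[OF \<delta>bar])
      fix \<delta>k :: "nat \<Rightarrow> real"
      assume \<delta>k: "\<And>k. \<delta>k k \<in> {0<..\<delta>bar}" "\<delta>k \<longlonglongrightarrow> 0"
      obtain s x where s: "strict_mono s"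
        and weak: "weakly_tendsto (\<lambda>k. xh (\<delta>k (s k))) x sequentially"
        using subseq[of \<delta>k, OF \<delta>k(1)] by blast
      have "(\<lambda>k. \<delta>k (s k)) \<longlonglongrightarrow> 0"
        using LIMSEQ_subseq_LIMSEQ[OF \<delta>k(2) s] by (simp add: o_def)
      then have "x = xd"
        using limit_solves[of "\<lambda>k. \<delta>k (s k)" x] \<delta>k(1) weak unique by blast
      then have "\<forall>\<^sub>F k in sequentially. dist (f (xh (\<delta>k (s k)))) (f xd) < e"
        using weak f \<open>0 < e\<close> tendstoD unfolding weakly_tendsto_def by blast
      then show "\<exists>k. dist (f (xh (\<delta>k k))) (f xd) < e"
        using eventually_happens by fastforce
    qed
  qed
  then have part3: "(\<forall>x\<in>D. F x = y \<longrightarrow> x = xd) \<longrightarrow>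
        weakly_tendsto xh xd (at_right 0) \<and>
        (Limsup (at_right 0) (\<lambda>\<delta>. ereal ((norm (xh \<delta>))\<^sup>2)) \<le> ereal ((norm xd)\<^sup>2) \<longrightarrow>
           (xh \<longlongrightarrow> xd) (at_right 0))"
    using weakly_tendsto_imp_tendsto by blast

  have rate: "(\<lambda>\<delta>. (norm (xh \<delta> - xd))\<^sup>2)
          \<in> O[at_right 0](\<lambda>\<delta>. \<phi> (max C2 (C4 * (\<tau> + \<tau>1 + \<tau>2 + 1)) * \<delta>))"
    if "0 < R" and C4: "0 < C4"
      and vsc: "variational_source_condition D F S \<phi> xd R"
      and tri: "generalized_triangle_inequality S C4"
      and ball: "(\<forall>x\<in>D. F x = y \<and> norm x \<le> norm xd \<longrightarrow> x \<in> ball xd R) \<or>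
         (\<forall>\<^sub>F \<delta> in at_right 0. xh \<delta> \<in> ball xd R)" for R C4
  proof -
    obtain \<beta> where \<beta>: "0 < \<beta>" "\<beta> < 1"
      and source: "\<And>x. x \<in> ball xd R \<Longrightarrow> x \<in> D \<Longrightarrow>
        2 * inner xd (xd - x) \<le> \<beta> * (norm (xd - x))\<^sup>2 + \<phi> (S y (F x))"
      using vsc xd(2) by (auto simp: variational_source_condition_def)
    have error_bound: "(1 - \<beta>) * (norm (x - xd))\<^sup>2 \<le> (norm x)\<^sup>2 - (norm xd)\<^sup>2 + \<phi> (S y (F x))"
      if "x \<in> ball xd R" "x \<in> D" for x
    proof -
      have "(norm (x - xd))\<^sup>2 = (norm x)\<^sup>2 - (norm xd)\<^sup>2 + 2 * inner xd (xd - x)"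
        by (simp add: power2_norm_eq_inner inner_simps inner_commute)
      with source[OF that] show ?thesis
        by (simp add: norm_minus_commute left_diff_distrib)
    qed
    have triangle: "S u v \<le> C4 * (S u w + S v w)" for u v w
      using tri by (auto simp: generalized_triangle_inequality_def)

    have in_ball: "\<forall>\<^sub>F \<delta> in at_right 0. xh \<delta> \<in> ball xd R"
      if sols: "\<forall>x\<in>D. F x = y \<and> norm x \<le> norm xd \<longrightarrow> x \<in> ball xd R"
    proof (rule eventually_at_right_if_sequences_meet[OF \<delta>bar])
      fix \<delta>k0 :: "nat \<Rightarrow> real"
      assume \<delta>k0: "\<And>k. \<delta>k0 k \<in> {0<..\<delta>bar}" "\<delta>k0 \<longlonglongrightarrow> 0"
      obtain s x where s: "strict_mono s"
        and weak0: "weakly_tendsto (\<lambda>k. xh (\<delta>k0 (s k))) x sequentially"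
        using subseq[of \<delta>k0, OF \<delta>k0(1)] by blast
      define \<delta>k where "\<delta>k = (\<lambda>k. \<delta>k0 (s k))"
      have \<delta>k: "\<And>k. \<delta>k k \<in> {0<..\<delta>bar}" "\<delta>k \<longlonglongrightarrow> 0"
        using \<delta>k0(1) LIMSEQ_subseq_LIMSEQ[OF \<delta>k0(2) s] by (auto simp: \<delta>k_def o_def)
      have weak: "weakly_tendsto (\<lambda>k. xh (\<delta>k k)) x sequentially"
        using weak0 by (simp add: \<delta>k_def)
      have x: "x \<in> D" "F x = y"
        using limit_solves[OF \<delta>k weak] by auto
      have norm_le: "(norm x)\<^sup>2 \<le> (norm xd)\<^sup>2"
        by (rule weak_limit_norm_le[OF weak _ _ bound_seq[OF \<delta>k]])
          (use norm_bound \<delta>k(1) in auto)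
      then have "x \<in> ball xd R"
        using sols x power2_le_imp_le norm_ge_zero by blast
      \<comment> \<open>The distance need not vanish on the diagonal by itself; data of arbitrarily small
        noise level force it to do so at \<open>y\<close>, which removes the index function from the source
        condition at \<open>x\<close>.\<close>
      moreover have "S y y = 0"
      proof (rule antisym[OF _ S_nonneg], rule tendsto_lowerbound)
        show "(\<lambda>k. C4 * (\<delta>k k + \<delta>k k)) \<longlonglongrightarrow> 0"
          using tendsto_mult_right_zero[OF tendsto_add_zero[OF \<delta>k(2) \<delta>k(2)]] .
        have "S y y \<le> C4 * (\<delta>k k + \<delta>k k)" for k
          using triangle[of y y "yd (\<delta>k k)"] noise[OF \<delta>k(1)] C4
          by (smt (verit) mult_left_mono)
        then show "\<forall>\<^sub>F k in sequentially. S y y \<le> C4 * (\<delta>k k + \<delta>k k)" by simp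
      qed simp
      ultimately have "(1 - \<beta>) * (norm (x - xd))\<^sup>2 \<le> (norm x)\<^sup>2 - (norm xd)\<^sup>2"
        using error_bound[of x] x index_function_at_0[OF \<phi>] by simp
      with norm_le have "(1 - \<beta>) * (norm (x - xd))\<^sup>2 \<le> 0" by linarith
      then have "x = xd"
        using \<beta> by (simp add: mult_le_0_iff)
      \<comment> \<open>Only because the limit is \<open>xd\<close> is the norm bound the limsup condition for strong convergence.\<close>
      have "limsup (\<lambda>k. ereal ((norm (xh (\<delta>k k)))\<^sup>2))
          \<le> limsup (\<lambda>k. ereal ((norm xd)\<^sup>2 + c * \<phi> (C2 * \<delta>k k)))"
        using norm_bound \<delta>k(1) by (intro Limsup_mono) auto
      also have "\<dots> = ereal ((norm xd)\<^sup>2)"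
        using bound_seq[OF \<delta>k] by (intro lim_imp_Limsup) auto
      finally have "(\<lambda>k. xh (\<delta>k k)) \<longlonglongrightarrow> xd"
        using weak \<open>x = xd\<close> weakly_tendsto_imp_tendsto by blast
      then have "\<forall>\<^sub>F k in sequentially. xh (\<delta>k k) \<in> ball xd R"
        using \<open>0 < R\<close> by (simp add: tendsto_iff dist_commute)
      then show "\<exists>k. xh (\<delta>k0 k) \<in> ball xd R"
        unfolding \<delta>k_def using eventually_happens by fastforce
    qed

    define C where "C = max C2 (C4 * (\<tau> + \<tau>1 + \<tau>2 + 1))"
    have bound: "(norm (xh \<delta> - xd))\<^sup>2 \<le> (c + 1) / (1 - \<beta>) * \<phi> (C * \<delta>)"
      if \<delta>: "\<delta> \<in> {0<..\<delta>bar}" and "xh \<delta> \<in> ball xd R" for \<delta>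
    proof -
      have "S y (F (xh \<delta>)) \<le> C4 * (S y (yd \<delta>) + S (F (xh \<delta>)) (yd \<delta>))"
        by (rule triangle)
      also have "\<dots> \<le> C4 * (\<delta> + K * \<delta>)"
        using C4 noise[OF \<delta>] residual_bound[OF \<delta>] by (intro mult_left_mono add_mono) auto
      also have "\<dots> = C4 * (\<tau> + \<tau>1 + \<tau>2 + 1) * \<delta>"
        by (simp add: K_def algebra_simps)
      also have "\<dots> \<le> C * \<delta>"
        using \<delta> by (intro mult_right_mono) (auto simp: C_def)
      finally have "\<phi> (S y (F (xh \<delta>))) \<le> \<phi> (C * \<delta>)"
        by (intro \<phi>_mono S_nonneg)
      moreover have "c * \<phi> (C2 * \<delta>) \<le> c * \<phi> (C * \<delta>)"
        using \<delta> c const_pos by (intro mult_left_mono \<phi>_mono mult_right_mono) (auto simp: C_def)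
      ultimately have "(1 - \<beta>) * (norm (xh \<delta> - xd))\<^sup>2 \<le> (c + 1) * \<phi> (C * \<delta>)"
        using error_bound[OF that(2) xh_D[OF \<delta>]] norm_bound[OF \<delta>] unfolding distrib_right by linarith
      then show ?thesis
        using \<beta> by (simp add: field_simps)
    qed
    have "\<forall>\<^sub>F \<delta> in at_right 0. \<delta> \<in> {0<..\<delta>bar}"
      using \<delta>bar by (auto simp: eventually_at_right_field intro!: exI[of _ \<delta>bar])
    moreover have "\<forall>\<^sub>F \<delta> in at_right 0. xh \<delta> \<in> ball xd R"
      using ball in_ball by blast
    ultimately have "\<forall>\<^sub>F \<delta> in at_right 0.
        norm ((norm (xh \<delta> - xd))\<^sup>2) \<le> (c + 1) / (1 - \<beta>) * norm (\<phi> (C * \<delta>))"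
    proof eventually_elim
      case (elim \<delta>)
      have "0 \<le> \<phi> (C * \<delta>)"
        using elim(1) const_pos by (intro \<phi>_nonneg mult_nonneg_nonneg) (auto simp: C_def)
      with bound[OF elim] show ?case by simp
    qed
    then show ?thesis
      unfolding C_def by (rule bigoI)
  qed
  from part1 part2 part3 rate show ?thesis by blast
qed

end
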